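(* Let $d_n = f_{321}(\mathrm{Av}_n(123))$ be the total number of occurrences of the pattern $321$ in all permutations in $\mathrm{Av}_n(123)$. Then, as formal Laurent series over $\mathbb{Q}$, $$\sum_{n\geq 0} d_n x^n = \frac{1}{2x}\left(\frac{ 8x^3 - 20x^2 + 8x - 1}{(1-4x)^{2}} - \frac{36x^3 - 34x^2 + 10x - 1}{(1-4x)^{5/2}}\right).$$
   Context: Permutations are written in one-line notation. For $p = p_1\cdots p_n \in S_n$ and $q = q_1 \cdots q_k\in S_k$, an occurrence of $q$ in $p$ (as a pattern) is a choice of indices $1 \le i_1 < \dots < i_k \le n$ such that $p_{i_1},\dots,p_{i_k}$ are in the same relative order as $q_1,\dots,q_k$ (i.e. $p_{i_s}<p_{i_t}$ iff $q_s<q_t$). $f_q(p)$ denotes the number of occurrences of $q$ in $p$, and $p$ avoids $q$ if $f_q(p)=0$. $\mathrm{Av}_n(r)$ is the set of permutations in $S_n$ avoiding $r$. For a finite set $\mathcal C$ of permutations, $f_q(\mathcal C)=\sum_{p\in\mathcal C} f_q(p)$. Powers $(1-4x)^{r}$ with $r$ a half-integer denote the binomial series with constant term $1$. *)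

theory Defs
  imports
    "HOL-Combinatorics.Multiset_Permutations"
    "HOL-Computational_Algebra.Formal_Laurent_Series"
begin

text \<open>
  Permutations are lists in one-line notation: \<open>S\<^sub>n\<close> is \<open>permutations_of_set {1..n}\<close>.
  Entries are counted from 1, but positions follow the list convention and are counted from 0.
\<close>

abbreviation perms :: "nat \<Rightarrow> nat list set" where
  "perms n \<equiv> permutations_of_set {1..n}"

text \<open>An occurrence is the list of its positions \<open>i\<^sub>1 < \<dots> < i\<^sub>k\<close>.\<close>

definition occurrences :: "nat list \<Rightarrow> nat list \<Rightarrow> nat list set" where
  "occurrences q p =
     {is. length is = length q \<and> set is \<subseteq> {..<length p} \<and> sorted_wrt (<) is \<and>
          (\<forall>s<length q. \<forall>t<length q. p ! (is ! s) < p ! (is ! t) \<longleftrightarrow> q ! s < q ! t)}"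

definition occ :: "nat list \<Rightarrow> nat list \<Rightarrow> nat" where
  "occ q p = card (occurrences q p)"

lemma finite_occurrences: "finite (occurrences q p)"
  by (rule finite_subset[OF _ finite_lists_length_eq[of "{..<length p}" "length q"]])
     (auto simp: occurrences_def)

definition avoids :: "nat list \<Rightarrow> nat list \<Rightarrow> bool" where
  "avoids p q \<longleftrightarrow> occ q p = 0"

definition Av :: "nat \<Rightarrow> nat list \<Rightarrow> nat list set" where
  "Av n r = {p \<in> perms n. avoids p r}"

lemma finite_Av: "finite (Av n r)"
  by (simp add: Av_def)

definition total_occ :: "nat list \<Rightarrow> nat list set \<Rightarrow> nat" where
  "total_occ q C = (\<Sum>p\<in>C. occ q p)"

text \<open>The binomial series \<open>(1 - 4x)\<^sup>r\<close>; its constant term is 1.\<close>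

definition one_minus_4x_powr :: "rat \<Rightarrow> rat fps" where
  "one_minus_4x_powr r = fps_compose (fps_binomial r) (- 4 * fps_X)"

end

theory Submission
  imports Defs
begin

text \<open>
  In a \<open>123\<close>-avoiding permutation let \<open>l\<^sub>j\<close> be the number of smaller entries to the left of position \<open>j\<close>.
  Those smaller entries are decreasing, so there are \<open>\<Sum>\<^sub>j l\<^sub>j\<close> occurrences of \<open>12\<close> and \<open>\<Sum>\<^sub>j (l\<^sub>j choose 2)\<close> of \<open>213\<close>;
  reverse-complement gives the same total for \<open>132\<close>. Weighing each triple of positions by
  \<open>1 - #(12) + #(132) + #(213)\<close> isolates \<open>321\<close>, so the total is determined by the moments of \<open>l\<^sub>j\<close>.
  Appending a last entry with \<open>l\<close> smaller entries turns a permutation with \<open>k\<close> admissible values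
  of \<open>l\<close> into one with \<open>k + 1\<close> (if \<open>l = 0\<close>) or \<open>l + 1\<close> admissible values: the Catalan generating tree. On
  the tree the generating functions satisfy a three-term recurrence in \<open>k\<close>, solved by a polynomial in \<open>k\<close> times \<open>C\<^sup>k\<close>,
  where \<open>C\<close> is the Catalan series. With \<open>s\<close> the square root of \<open>1 - 4x\<close>, the totals
  for \<open>12\<close> and \<open>213\<close> become \<open>((1/s - 1)/2)\<^sup>2\<close> and \<open>((1/s - 1)/2)\<^sup>3\<close>.
\<close>

section \<open>Generating functions of the Catalan tree\<close>

text \<open>A label is the number of children. Under a node labelled \<open>k\<close> the child
  labels are \<open>2, ..., k + 1\<close>, each once: the Catalan succession rule.\<close>

definition tree_child :: "nat \<Rightarrow> nat \<Rightarrow> nat" where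
  "tree_child k l = (if l = 0 then Suc k else Suc l)"

text \<open>The number of nodes \<open>m\<close> levels below a node labelled
  \<open>k\<close>.\<close>

primrec tree_paths :: "nat \<Rightarrow> nat \<Rightarrow> 'a :: comm_semiring_1" where
  "tree_paths 0 k = 1"
| "tree_paths (Suc m) k = (\<Sum>l<k. tree_paths m (tree_child k l))"

text \<open>Adds up \<open>\<phi> l\<close> over all choices \<open>l\<close> on all paths of length
  \<open>m\<close> from label \<open>k\<close>; the first choice counts once per
  continuation.\<close>

primrec tree_weight :: "(nat \<Rightarrow> 'a :: comm_semiring_1) \<Rightarrow> nat \<Rightarrow> nat \<Rightarrow> 'a" where
  "tree_weight \<phi> 0 k = 0"
| "tree_weight \<phi> (Suc m) k =
     (\<Sum>l<k. \<phi> l * tree_paths m (tree_child k l) + tree_weight \<phi> m (tree_child k l))"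

text \<open>As multisets, the child labels are \<open>2, ..., k + 1\<close> for label
  \<open>k\<close>, and the same together with \<open>k + 2\<close> for label
  \<open>k + 1\<close>.\<close>

lemma sum_tree_child_Suc:
  "(\<Sum>l<Suc k. h (tree_child (Suc k) l)) = (\<Sum>l<k. h (tree_child k l)) + (h (k + 2) :: 'a :: comm_monoid_add)"
proof (cases k)
  case (Suc k')
  have "(\<Sum>l<Suc k. h (tree_child (Suc k) l)) = h (k + 2) + ((\<Sum>l<k'. h (l + 2)) + h (k + 1))"
    by (subst sum.lessThan_Suc_shift) (simp add: tree_child_def Suc)
  moreover have "(\<Sum>l<k. h (tree_child k l)) = h (k + 1) + (\<Sum>l<k'. h (l + 2))"
    unfolding Suc by (subst sum.lessThan_Suc_shift) (simp add: tree_child_def)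
  ultimately show ?thesis
    by (simp add: ac_simps)
qed (simp add: tree_child_def)

lemma tree_paths_Suc_Suc:
  "tree_paths (Suc m) (Suc k) = tree_paths (Suc m) k + tree_paths m (k + 2)"
  by (simp only: tree_paths.simps sum_tree_child_Suc)

text \<open>The choice \<open>l = 0\<close> is the only one whose child label depends on the parent,
  and \<open>\<phi> 0 = 0\<close> gives it no weight. So the first choices contribute just one new
  term, that of \<open>l = k\<close>.\<close>

lemma tree_weight_Suc_Suc:
  assumes "\<phi> 0 = 0"
  shows "tree_weight \<phi> (Suc m) (Suc k) =
           tree_weight \<phi> (Suc m) k + tree_weight \<phi> m (k + 2) + \<phi> k * tree_paths m (Suc k)"
proof -
  have "\<phi> l * tree_paths m (tree_child j l) = \<phi> l * tree_paths m (Suc l)" for j l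
    using assms by (simp add: tree_child_def)
  then have "tree_weight \<phi> (Suc m) j =
      (\<Sum>l<j. \<phi> l * tree_paths m (Suc l)) + (\<Sum>l<j. tree_weight \<phi> m (tree_child j l))" for j
    by (simp add: sum.distrib)
  then show ?thesis
    by (simp only: sum_tree_child_Suc sum.lessThan_Suc ac_simps)
qed

text \<open>Coefficient \<open>m\<close> of \<open>H (k + 1)\<close> involves only coefficient
  \<open>m\<close> of \<open>H k\<close> and coefficient \<open>m - 1\<close> of
  \<open>H (k + 2)\<close>: induction on \<open>m\<close> outside, on \<open>k\<close> inside.
  Applied to differences, this is uniqueness for given \<open>H 0\<close>.\<close>

lemma fps_three_term_recurrence_zero:
  fixes H :: "nat \<Rightarrow> 'a :: comm_ring_1 fps"
  assumes H0: "H 0 = 0" and rec: "\<And>k. H (Suc k) = H k + fps_X * H (k + 2)"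
  shows "H k = 0"
proof -
  have "H k $ m = 0" for m k
  proof (induction m arbitrary: k)
    case 0
    show ?case
    proof (induction k)
      case (Suc k)
      then show ?case using rec[of k] by simp
    qed (simp add: H0)
  next
    case (Suc m)
    note IH = Suc
    show ?case
    proof (induction k)
      case (Suc k)
      then show ?case using rec[of k] IH[of "k + 2"] by simp
    qed (simp add: H0)
  qed
  then show ?thesis by (simp add: fps_eq_iff)
qed

section \<open>The square root of 1 - 4x and the Catalan series\<close>

definition sqrt_fps :: "rat fps" where
  "sqrt_fps = one_minus_4x_powr (1 / 2)"

text \<open>This is (1 - s) / (2x): the shift divides by x, exactly so because s has constant term
  1.\<close>

definition catalan_fps :: "rat fps" where
  "catalan_fps = fps_shift 1 (fps_const (1 / 2) * (1 - sqrt_fps))"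

lemma one_minus_4x_powr_add: "one_minus_4x_powr (a + b) = one_minus_4x_powr a * one_minus_4x_powr b"
  by (simp add: one_minus_4x_powr_def fps_binomial_add_mult fps_compose_mult_distrib)

lemma one_minus_4x_powr_1: "one_minus_4x_powr 1 = 1 - 4 * fps_X"
  by (simp add: one_minus_4x_powr_def fps_binomial_1 fps_compose_add_distrib)

lemma sqrt_fps_square: "sqrt_fps * sqrt_fps = 1 - 4 * fps_X"
  using one_minus_4x_powr_add[of "1/2" "1/2"] by (simp add: sqrt_fps_def one_minus_4x_powr_1)

lemma sqrt_fps_nth_0: "sqrt_fps $ 0 = 1"
  by (simp add: sqrt_fps_def one_minus_4x_powr_def)

lemma one_minus_4x_powr_5_2: "one_minus_4x_powr (5 / 2) = (1 - 4 * fps_X) ^ 2 * sqrt_fps"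
proof -
  have "one_minus_4x_powr (5 / 2) = one_minus_4x_powr (1 + (1 + 1 / 2))"
    by simp
  also have "\<dots> = (1 - 4 * fps_X) ^ 2 * sqrt_fps"
    by (simp only: one_minus_4x_powr_add one_minus_4x_powr_1 sqrt_fps_def power2_eq_square mult.assoc)
  finally show ?thesis .
qed

lemma catalan_fps_sqrt: "2 * fps_X * catalan_fps = 1 - sqrt_fps"
proof -
  have "fps_X * catalan_fps = fps_const (1 / 2) * (1 - sqrt_fps)"
  proof (rule fps_ext)
    show "(fps_X * catalan_fps) $ m = (fps_const (1 / 2) * (1 - sqrt_fps)) $ m" for m
      by (cases m) (simp_all add: catalan_fps_def sqrt_fps_nth_0)
  qed
  then have "2 * (fps_X * catalan_fps) = (2 * fps_const (1 / 2)) * (1 - sqrt_fps)"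
    by (simp add: mult.assoc)
  also have "2 * fps_const (1 / 2) = (1 :: rat fps)"
    by (simp add: numeral_fps_const)
  finally show ?thesis by (simp add: mult.assoc)
qed

text \<open>Completing the square: 4x times the equation is s^2 = 1 - 4x with s = 1 - 2xC, and 4x
  can be cancelled.\<close>

lemma catalan_fps_quadratic: "catalan_fps = 1 + fps_X * catalan_fps ^ 2"
proof -
  have "4 * fps_X * (catalan_fps - (1 + fps_X * catalan_fps ^ 2)) = (1 - 4 * fps_X) - (1 - 2 * fps_X * catalan_fps)\<^sup>2"
    by (simp add: algebra_simps power2_eq_square)
  also have "\<dots> = 0"
    by (simp add: catalan_fps_sqrt power2_eq_square sqrt_fps_square)
  finally show ?thesis by simp
qed

section \<open>Closed forms for the tree series\<close>

text \<open>Both sides are 1 at \<open>k = 0\<close> and satisfy the same recurrence, which for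
  powers of C is the quadratic equation times C^k.\<close>

lemma fps_tree_paths: "Abs_fps (\<lambda>m. tree_paths m k) = catalan_fps ^ k"
proof -
  define G :: "nat \<Rightarrow> rat fps" where "G = (\<lambda>k. Abs_fps (\<lambda>m. tree_paths m k))"
  have G0: "G 0 = 1"
  proof (rule fps_ext)
    show "G 0 $ m = 1 $ m" for m by (cases m) (simp_all add: G_def)
  qed
  have rec: "G (Suc k) = G k + fps_X * G (k + 2)" for k
  proof (rule fps_ext)
    show "G (Suc k) $ m = (G k + fps_X * G (k + 2)) $ m" for m
      by (cases m) (simp_all add: G_def tree_paths_Suc_Suc del: tree_paths.simps(2))
  qed
  have "catalan_fps ^ Suc k = catalan_fps ^ k + fps_X * catalan_fps ^ (k + 2)" for k
    by (subst power_Suc, subst catalan_fps_quadratic) (simp add: algebra_simps power2_eq_square)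
  note C = this
  have "G k - catalan_fps ^ k = 0"
  proof (rule fps_three_term_recurrence_zero[where H = "\<lambda>k. G k - catalan_fps ^ k"])
    show "G (Suc k) - catalan_fps ^ Suc k =
        G k - catalan_fps ^ k + fps_X * (G (k + 2) - catalan_fps ^ (k + 2))" for k
      unfolding rec[of k] C[of k] by (simp only: algebra_simps)
  qed (simp add: G0)
  then show ?thesis by (simp add: G_def)
qed

lemma fps_tree_weight_Suc:
  assumes "\<phi> 0 = (0 :: rat)"
  shows "Abs_fps (\<lambda>m. tree_weight \<phi> m (Suc k)) = Abs_fps (\<lambda>m. tree_weight \<phi> m k) +
    fps_X * Abs_fps (\<lambda>m. tree_weight \<phi> m (k + 2)) + fps_const (\<phi> k) * fps_X * catalan_fps ^ Suc k"
proof (rule fps_ext)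
  fix m
  show "Abs_fps (\<lambda>m. tree_weight \<phi> m (Suc k)) $ m = (Abs_fps (\<lambda>m. tree_weight \<phi> m k) +
    fps_X * Abs_fps (\<lambda>m. tree_weight \<phi> m (k + 2)) + fps_const (\<phi> k) * fps_X * catalan_fps ^ Suc k) $ m"
    unfolding fps_tree_paths[symmetric]
    by (cases m) (simp_all add: tree_weight_Suc_Suc assms mult.assoc del: tree_weight.simps(2) tree_paths.simps(2))
qed

lemma fps_tree_weight_0: "Abs_fps (\<lambda>m. tree_weight \<phi> m 0) = 0"
proof (rule fps_ext)
  show "Abs_fps (\<lambda>m. tree_weight \<phi> m 0) $ m = 0 $ m" for m by (cases m) simp_all
qed

text \<open>The condition on \<open>P\<close> is the recurrence for
  \<open>P k * catalan_fps ^ k\<close> divided by C^k. The factor \<open>c\<close> clears powers of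
  1/s, so that \<open>P\<close> can be written with powers of s alone.\<close>

lemma fps_tree_weight_closed_form:
  fixes \<phi> :: "nat \<Rightarrow> rat" and P :: "nat \<Rightarrow> rat fps"
  assumes \<phi>0: "\<phi> 0 = 0" and P0: "P 0 = 0"
    and P: "\<And>k. P (Suc k) * catalan_fps - P k - fps_X * P (k + 2) * catalan_fps ^ 2 =
                  c * fps_const (\<phi> k) * fps_X * catalan_fps"
  shows "c * Abs_fps (\<lambda>m. tree_weight \<phi> m k) = P k * catalan_fps ^ k"
proof -
  define A :: "nat \<Rightarrow> rat fps" where "A = (\<lambda>k. Abs_fps (\<lambda>m. tree_weight \<phi> m k))"
  have A: "A (Suc k) = A k + fps_X * A (k + 2) + fps_const (\<phi> k) * fps_X * catalan_fps ^ Suc k" for k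
    using fps_tree_weight_Suc[of \<phi> k] \<phi>0 by (simp add: A_def)
  have "catalan_fps ^ k * (P (Suc k) * catalan_fps - P k - fps_X * P (k + 2) * catalan_fps ^ 2) =
     catalan_fps ^ k * (c * fps_const (\<phi> k) * fps_X * catalan_fps)" for k
    by (simp only: P)
  then have PC: "P (Suc k) * catalan_fps ^ Suc k = P k * catalan_fps ^ k +
      fps_X * (P (k + 2) * catalan_fps ^ (k + 2)) + c * fps_const (\<phi> k) * fps_X * catalan_fps ^ Suc k" for k
    by (simp add: algebra_simps power2_eq_square)
  have "c * A k - P k * catalan_fps ^ k = 0"
  proof (rule fps_three_term_recurrence_zero[where H = "\<lambda>k. c * A k - P k * catalan_fps ^ k"])
    show "c * A 0 - P 0 * catalan_fps ^ 0 = 0"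
      by (simp add: A_def P0 fps_tree_weight_0)
    show "c * A (Suc k) - P (Suc k) * catalan_fps ^ Suc k = c * A k - P k * catalan_fps ^ k +
        fps_X * (c * A (k + 2) - P (k + 2) * catalan_fps ^ (k + 2))" for k
      unfolding A PC by (simp add: algebra_simps)
  qed
  then show ?thesis by (simp add: A_def)
qed

definition inv_sqrt_fps :: "rat fps" where
  "inv_sqrt_fps = inverse sqrt_fps"

lemma inv_sqrt_fps: "inv_sqrt_fps * sqrt_fps = 1"
  unfolding inv_sqrt_fps_def by (rule inverse_mult_eq_1) (simp add: sqrt_fps_nth_0)

text \<open>
  The polynomials in \<open>k\<close> below come from undetermined coefficients, cleared of powers of \<open>1/s\<close>.
\<close>

lemma fps_tree_weight_linear:
  "4 * Abs_fps (\<lambda>m. tree_weight of_nat m (Suc 0)) = (inv_sqrt_fps - 1) ^ 2"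
proof -
  have "2 * (1 - 4 * fps_X) * Abs_fps (\<lambda>m. tree_weight of_nat m k) =
     fps_X * (sqrt_fps * of_nat k ^ 2 + (1 - 2 * sqrt_fps) * of_nat k) * catalan_fps ^ k" for k
  proof (rule fps_tree_weight_closed_form)
    fix k
    show "fps_X * (sqrt_fps * of_nat (Suc k) ^ 2 + (1 - 2 * sqrt_fps) * of_nat (Suc k)) * catalan_fps
       - fps_X * (sqrt_fps * of_nat k ^ 2 + (1 - 2 * sqrt_fps) * of_nat k)
       - fps_X * (fps_X * (sqrt_fps * of_nat (k + 2) ^ 2 + (1 - 2 * sqrt_fps) * of_nat (k + 2))) * catalan_fps ^ 2
       = 2 * (1 - 4 * fps_X) * fps_const (of_nat k) * fps_X * catalan_fps"
      using catalan_fps_quadratic catalan_fps_sqrt sqrt_fps_square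
      unfolding of_nat_add of_nat_Suc of_nat_numeral fps_of_nat by algebra
  qed simp_all
  \<comment> \<open>At \<open>k = 1\<close> the bracket collapses to 1 - s, and xC = (1 - s)/2 turns
    the right side into (1 - s)^2 / 2.\<close>
  from this[of "Suc 0"]
  have "2 * (1 - 4 * fps_X) * Abs_fps (\<lambda>m. tree_weight of_nat m (Suc 0)) =
      fps_X * (1 - sqrt_fps) * catalan_fps"
    by simp
  then show ?thesis
    using catalan_fps_sqrt sqrt_fps_square inv_sqrt_fps by algebra
qed

lemma fps_tree_weight_choose_two:
  "8 * Abs_fps (\<lambda>m. tree_weight (\<lambda>l. of_nat (l choose 2)) m (Suc 0)) = (inv_sqrt_fps - 1) ^ 3"
proof -
  have choose: "2 * fps_const (of_nat (k choose 2)) = of_nat k * (of_nat k - (1 :: rat fps))" for k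
  proof -
    \<comment> \<open>Stated with a sum, since subtraction on the naturals truncates.\<close>
    have "2 * (k choose 2) + k = k * k"
      by (induction k) (simp_all add: choose_two numeral_2_eq_2)
    then have "of_nat (2 * (k choose 2) + k) = (of_nat (k * k) :: rat fps)"
      by (simp only:)
    then show ?thesis by (simp add: fps_of_nat algebra_simps)
  qed
  have "12 * sqrt_fps ^ 3 * Abs_fps (\<lambda>m. tree_weight (\<lambda>l. of_nat (l choose 2)) m k) =
     fps_X * (2 * sqrt_fps ^ 2 * of_nat k ^ 3 + (3 * sqrt_fps - 9 * sqrt_fps ^ 2) * of_nat k ^ 2
       + (10 * sqrt_fps ^ 2 + 3 - 9 * sqrt_fps) * of_nat k) * catalan_fps ^ k" for k
  proof (rule fps_tree_weight_closed_form)
    fix k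
    let ?P = "\<lambda>k. fps_X * (2 * sqrt_fps ^ 2 * of_nat k ^ 3 + (3 * sqrt_fps - 9 * sqrt_fps ^ 2) * of_nat k ^ 2
       + (10 * sqrt_fps ^ 2 + 3 - 9 * sqrt_fps) * of_nat k) :: rat fps"
    show "?P (Suc k) * catalan_fps - ?P k - fps_X * ?P (k + 2) * catalan_fps ^ 2
       = 12 * sqrt_fps ^ 3 * fps_const (of_nat (k choose 2)) * fps_X * catalan_fps"
      using catalan_fps_quadratic catalan_fps_sqrt sqrt_fps_square choose[of k]
      unfolding of_nat_add of_nat_Suc of_nat_numeral by algebra
  qed simp_all
  \<comment> \<open>At \<open>k = 1\<close> the bracket collapses to 3 (1 - s)^2.\<close>
  from this[of "Suc 0"]
  have "12 * sqrt_fps ^ 3 * Abs_fps (\<lambda>m. tree_weight (\<lambda>l. of_nat (l choose 2)) m (Suc 0)) =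
      fps_X * (3 * sqrt_fps ^ 2 - 6 * sqrt_fps + 3) * catalan_fps"
    by (simp add: algebra_simps)
  then have "3 * (8 * Abs_fps (\<lambda>m. tree_weight (\<lambda>l. of_nat (l choose 2)) m (Suc 0)))
      = 3 * (inv_sqrt_fps - 1) ^ 3"
    using catalan_fps_sqrt sqrt_fps_square inv_sqrt_fps by algebra
  then show ?thesis
    by (rule mult_left_cancel[THEN iffD1, rotated]) simp
qed

section \<open>Derivatives and binomial moments\<close>

text \<open>With r = 1/s, differentiating s^2 = 1 - 4x and r s = 1 gives s' = -2r and r' = -r^2
  s'.\<close>

lemma fps_deriv_inv_sqrt_fps: "fps_deriv inv_sqrt_fps = 2 * inv_sqrt_fps ^ 3"
proof -
  have "fps_deriv (sqrt_fps * sqrt_fps) = - 4"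
    by (simp add: sqrt_fps_square)
  then have s: "2 * (sqrt_fps * fps_deriv sqrt_fps) = - 4"
    by (simp add: algebra_simps)
  have "fps_deriv (inv_sqrt_fps * sqrt_fps) = 0"
    by (simp add: inv_sqrt_fps)
  then have "inv_sqrt_fps * fps_deriv sqrt_fps + fps_deriv inv_sqrt_fps * sqrt_fps = 0"
    by simp
  then have "2 * fps_deriv inv_sqrt_fps = 2 * (2 * inv_sqrt_fps ^ 3)"
    using s inv_sqrt_fps by algebra
  then show ?thesis
    by (rule mult_left_cancel[THEN iffD1, rotated]) simp
qed

text \<open>Writing s as (1 - 4x) / s lets 2xC = 1 - s be differentiated using the derivative of 1/s
  alone.\<close>

lemma fps_X_deriv_catalan_fps: "fps_X * fps_deriv catalan_fps = inv_sqrt_fps - catalan_fps"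
proof -
  have "sqrt_fps = (1 - 4 * fps_X) * inv_sqrt_fps"
    using sqrt_fps_square inv_sqrt_fps by algebra
  then have "2 * fps_X * catalan_fps = 1 - (1 - 4 * fps_X) * inv_sqrt_fps"
    using catalan_fps_sqrt by simp
  then have "fps_deriv (2 * fps_X * catalan_fps) = fps_deriv (1 - (1 - 4 * fps_X) * inv_sqrt_fps)"
    by simp
  then have "2 * (catalan_fps + fps_X * fps_deriv catalan_fps) =
      4 * inv_sqrt_fps - (1 - 4 * fps_X) * (2 * inv_sqrt_fps ^ 3)"
    by (simp add: fps_deriv_inv_sqrt_fps algebra_simps)
  then have "2 * (fps_X * fps_deriv catalan_fps) = 2 * (inv_sqrt_fps - catalan_fps)"
    using sqrt_fps_square inv_sqrt_fps by algebra
  then show ?thesis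
    by (rule mult_left_cancel[THEN iffD1, rotated]) simp
qed

text \<open>The operator \<theta> = x d/dx multiplies coefficient \<open>n\<close> by
  \<open>n\<close>, and 6 (n choose 3) = n^3 - 3 n^2 + 2n.\<close>

lemma fps_choose_three_catalan:
  "Abs_fps (\<lambda>n. of_nat (n choose 3) * catalan_fps $ n) =
     2 * fps_X ^ 2 * inv_sqrt_fps ^ 5 - fps_X * inv_sqrt_fps ^ 3 + inv_sqrt_fps - catalan_fps"
proof -
  define \<theta> :: "rat fps \<Rightarrow> rat fps" where "\<theta> = (\<lambda>f. fps_X * fps_deriv f)"
  have \<theta>_nth: "\<theta> f $ n = of_nat n * f $ n" for f n
    by (cases n) (simp_all add: \<theta>_def)
  have choose: "6 * of_nat (n choose 3) = of_nat n * (of_nat n - 1) * (of_nat n - (2 :: rat))" for n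
    by (simp add: binomial_gbinomial gbinomial_prod_rev fact_numeral eval_nat_numeral lessThan_Suc atLeast0_lessThan_Suc)
  have "6 * Abs_fps (\<lambda>n. of_nat (n choose 3) * catalan_fps $ n) =
      \<theta> (\<theta> (\<theta> catalan_fps)) - 3 * \<theta> (\<theta> catalan_fps) + 2 * \<theta> catalan_fps"
  proof (rule fps_ext)
    fix n
    have "(6 * of_nat (n choose 3)) * catalan_fps $ n =
       (of_nat n * (of_nat n * (of_nat n * catalan_fps $ n)) - 3 * (of_nat n * (of_nat n * catalan_fps $ n)) +
        2 * (of_nat n * catalan_fps $ n))"
      unfolding choose by (simp add: algebra_simps)
    then show "(6 * Abs_fps (\<lambda>n. of_nat (n choose 3) * catalan_fps $ n)) $ n =
      (\<theta> (\<theta> (\<theta> catalan_fps)) - 3 * \<theta> (\<theta> catalan_fps) + 2 * \<theta> catalan_fps) $ n"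
      by (simp add: \<theta>_nth numeral_fps_const)
  qed
  also have "\<dots> = 6 * (2 * fps_X ^ 2 * inv_sqrt_fps ^ 5 - fps_X * inv_sqrt_fps ^ 3 + inv_sqrt_fps - catalan_fps)"
  proof -
    have 1: "\<theta> catalan_fps = inv_sqrt_fps - catalan_fps"
      by (simp add: \<theta>_def fps_X_deriv_catalan_fps)
    have r: "\<theta> inv_sqrt_fps = 2 * fps_X * inv_sqrt_fps ^ 3"
      by (simp add: \<theta>_def fps_deriv_inv_sqrt_fps)
    have diff: "\<theta> (f - g) = \<theta> f - \<theta> g" for f g
      by (simp add: \<theta>_def algebra_simps)
    have 2: "\<theta> (2 * fps_X * inv_sqrt_fps ^ 3) = 2 * fps_X * inv_sqrt_fps ^ 3 + 12 * fps_X ^ 2 * inv_sqrt_fps ^ 5"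
      by (simp add: \<theta>_def fps_deriv_inv_sqrt_fps power3_eq_cube eval_nat_numeral algebra_simps)
    show ?thesis
      unfolding 1 diff r 2 by (simp add: algebra_simps)
  qed
  finally show ?thesis
    by (rule mult_left_cancel[THEN iffD1, rotated]) simp
qed

text \<open>The hypothesis is the count derived from permutations below. Its factor \<open>n\<close>
  becomes x d/dx, and multiplying by 2x s^5 keeps the identity inside power series.\<close>

lemma fps_pattern_321:
  fixes d :: "nat \<Rightarrow> rat"
  assumes d: "\<And>n. d n = of_nat (n choose 3) * tree_paths n (Suc 0)
     - (of_nat n - 2) * tree_weight of_nat n (Suc 0)
     + 2 * tree_weight (\<lambda>l. of_nat (l choose 2)) n (Suc 0)"
  shows "2 * fps_X * one_minus_4x_powr (5 / 2) * Abs_fps d =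
    (8 * fps_X ^ 3 - 20 * fps_X ^ 2 + 8 * fps_X - 1) * sqrt_fps
      - (36 * fps_X ^ 3 - 34 * fps_X ^ 2 + 10 * fps_X - 1)"
proof -
  define A :: "rat fps" where "A = Abs_fps (\<lambda>m. tree_weight of_nat m (Suc 0))"
  define B :: "rat fps" where "B = Abs_fps (\<lambda>m. tree_weight (\<lambda>l. of_nat (l choose 2)) m (Suc 0))"
  define T :: "rat fps" where "T = Abs_fps (\<lambda>n. of_nat (n choose 3) * catalan_fps $ n)"
  have paths: "tree_paths n (Suc 0) = catalan_fps $ n" for n
    using arg_cong[OF fps_tree_paths[of "Suc 0"], of "\<lambda>f. f $ n"] by simp
  have D: "Abs_fps d = T - (fps_X * fps_deriv A - 2 * A) + 2 * B"
  proof (rule fps_ext)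
    fix n
    have "(fps_X * fps_deriv A) $ n = of_nat n * A $ n"
      by (cases n) simp_all
    then show "Abs_fps d $ n = (T - (fps_X * fps_deriv A - 2 * A) + 2 * B) $ n"
      by (simp add: d paths T_def numeral_fps_const) (simp add: A_def B_def algebra_simps)
  qed
  have A: "4 * A = (inv_sqrt_fps - 1) ^ 2"
    using fps_tree_weight_linear by (simp add: A_def)
  have "fps_deriv (4 * A) = fps_deriv ((inv_sqrt_fps - 1) ^ 2)"
    by (simp only: A)
  then have A': "4 * fps_deriv A = 2 * (inv_sqrt_fps - 1) * (2 * inv_sqrt_fps ^ 3)"
    by (simp add: fps_deriv_inv_sqrt_fps power2_eq_square algebra_simps)
  have B: "8 * B = (inv_sqrt_fps - 1) ^ 3"
    using fps_tree_weight_choose_two by (simp add: B_def)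
  have T: "T = 2 * fps_X ^ 2 * inv_sqrt_fps ^ 5 - fps_X * inv_sqrt_fps ^ 3 + inv_sqrt_fps - catalan_fps"
    by (simp add: T_def fps_choose_three_catalan)
  \<comment> \<open>The factor 4 makes \<open>4 * A\<close>, its derivative and \<open>8 * B\<close>
    appear, whose values are known.\<close>
  have "4 * (2 * fps_X * one_minus_4x_powr (5 / 2) * Abs_fps d) =
    4 * ((8 * fps_X ^ 3 - 20 * fps_X ^ 2 + 8 * fps_X - 1) * sqrt_fps
      - (36 * fps_X ^ 3 - 34 * fps_X ^ 2 + 10 * fps_X - 1))"
    unfolding D one_minus_4x_powr_5_2
    using A A' B T catalan_fps_sqrt sqrt_fps_square inv_sqrt_fps by algebra
  then show ?thesis
    by (rule mult_left_cancel[THEN iffD1, rotated]) simp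
qed

text \<open>In the field of Laurent series the cleared denominators can be divided out again: x, s
  and 1 - 4x = s^2 are nonzero.\<close>

lemma fls_pattern_321:
  fixes D :: "rat fps" and x :: "rat fls"
  assumes D: "2 * fps_X * one_minus_4x_powr (5 / 2) * D =
    (8 * fps_X ^ 3 - 20 * fps_X ^ 2 + 8 * fps_X - 1) * sqrt_fps
      - (36 * fps_X ^ 3 - 34 * fps_X ^ 2 + 10 * fps_X - 1)"
    and x: "x = fls_X"
  shows "fps_to_fls D = 1 / (2 * x) *
             ((8 * x ^ 3 - 20 * x ^ 2 + 8 * x - 1) / (1 - 4 * x) ^ 2
              - (36 * x ^ 3 - 34 * x ^ 2 + 10 * x - 1) / fps_to_fls (one_minus_4x_powr (5 / 2)))"
proof -
  define s where "s = fps_to_fls sqrt_fps"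
  define d where "d = fps_to_fls D"
  define y where "y = 1 - 4 * x"
  have q: "fps_to_fls (one_minus_4x_powr (5 / 2)) = y ^ 2 * s"
    by (simp add: one_minus_4x_powr_5_2 s_def y_def x fls_times_fps_to_fls fps_to_fls_power
        fps_to_fls_minus fps_to_fls_numeral)
  have "fps_to_fls (2 * fps_X * one_minus_4x_powr (5 / 2) * D) =
    fps_to_fls ((8 * fps_X ^ 3 - 20 * fps_X ^ 2 + 8 * fps_X - 1) * sqrt_fps
      - (36 * fps_X ^ 3 - 34 * fps_X ^ 2 + 10 * fps_X - 1))"
    by (simp only: D)
  then have eq: "2 * x * (y ^ 2 * s) * d = (8 * x ^ 3 - 20 * x ^ 2 + 8 * x - 1) * s
      - (36 * x ^ 3 - 34 * x ^ 2 + 10 * x - 1)"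
    by (simp add: fls_times_fps_to_fls q d_def[symmetric] s_def[symmetric] x fps_to_fls_power
        fps_to_fls_minus fps_to_fls_plus fps_to_fls_numeral)
  have s0: "s \<noteq> 0"
    using sqrt_fps_nth_0 by (auto simp: s_def)
  have "sqrt_fps * sqrt_fps = 1 - 4 * fps_X" by (rule sqrt_fps_square)
  then have "fps_to_fls (sqrt_fps * sqrt_fps) = fps_to_fls (1 - 4 * fps_X)" by simp
  then have "s * s = y"
    by (simp add: fls_times_fps_to_fls s_def y_def x fps_to_fls_minus fps_to_fls_numeral)
  with s0 have y0: "y \<noteq> 0" by auto
  have x0: "x \<noteq> 0" by (simp add: x)
  have "2 * x * (y ^ 2 * s) * d = U * s - V \<Longrightarrow> d = 1 / (2 * x) * (U / y ^ 2 - V / (y ^ 2 * s))" for U V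
    using x0 y0 s0 by (simp add: divide_simps) (simp add: algebra_simps)
  from this[OF eq] show ?thesis
    by (simp only: q d_def y_def)
qed

declare One_nat_def [simp del]

section \<open>Permutations avoiding 123\<close>

text \<open>Written as a sum of indicators, so that identities valid on each triple of positions can
  be summed; \<open>k\<close> is the rightmost position.\<close>

definition occ3 :: "(nat \<Rightarrow> nat \<Rightarrow> nat \<Rightarrow> bool) \<Rightarrow> nat list \<Rightarrow> nat" where
  "occ3 Q p = (\<Sum>k<length p. \<Sum>j<k. \<Sum>i<j. of_bool (Q (p ! i) (p ! j) (p ! k)))"

lemma occ3_eq_card:
  "occ3 Q p = card {(k, j, i). i < j \<and> j < k \<and> k < length p \<and> Q (p ! i) (p ! j) (p ! k)}"
proof -
  have "occ3 Q p = card (SIGMA k:{..<length p}. SIGMA j:{..<k}. {i \<in> {..<j}. Q (p ! i) (p ! j) (p ! k)})"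
    by (simp add: occ3_def of_bool_def flip: sum.inter_filter)
  also have "(SIGMA k:{..<length p}. SIGMA j:{..<k}. {i \<in> {..<j}. Q (p ! i) (p ! j) (p ! k)}) =
      {(k, j, i). i < j \<and> j < k \<and> k < length p \<and> Q (p ! i) (p ! j) (p ! k)}"
    by auto
  finally show ?thesis .
qed

lemma all_less_3: "(\<forall>s<3. R s) \<longleftrightarrow> R 0 \<and> R 1 \<and> R (2 :: nat)"
  by (auto simp: eval_nat_numeral less_Suc_eq One_nat_def)

lemma occ_eq_occ3:
  assumes Q: "\<And>x y z. Q x y z \<longleftrightarrow> (\<forall>s<3. \<forall>t<3. [x, y, z] ! s < [x, y, z] ! t \<longleftrightarrow> [a, b, c] ! s < [a, b, c] ! t)"
  shows "occ [a, b, c] p = occ3 Q p"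
proof -
  let ?T = "{(k, j, i). i < j \<and> j < k \<and> k < length p \<and> Q (p ! i) (p ! j) (p ! k)}"
  have occurrences: "is \<in> occurrences [a, b, c] p \<longleftrightarrow> is \<in> (\<lambda>(k, j, i). [i, j, k]) ` ?T" for "is"
  proof (cases "length is = 3")
    case True
    then obtain i j k where "is": "is = [i, j, k]"
      by (auto simp: numeral_3_eq_3 length_Suc_conv)
    have 3: "length [a, b, c] = 3" by simp
    show ?thesis
      unfolding "is" occurrences_def Q 3 all_less_3 by (auto simp: image_iff)
  qed (auto simp: occurrences_def)
  have "card ((\<lambda>(k, j, i). [i, j, k]) ` ?T) = card ?T"
    by (rule card_image) (auto simp: inj_on_def)
  moreover have "occurrences [a, b, c] p = (\<lambda>(k, j, i). [i, j, k]) ` ?T"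
    using occurrences by blast
  ultimately show ?thesis
    by (simp only: occ_def occ3_eq_card)
qed

lemma occ_123: "occ [1, 2, 3] p = occ3 (\<lambda>x y z. x < y \<and> y < z) p"
  by (rule occ_eq_occ3) (auto simp: all_less_3)

lemma occ_321: "occ [3, 2, 1] p = occ3 (\<lambda>x y z. z < y \<and> y < x) p"
  by (rule occ_eq_occ3) (auto simp: all_less_3)

lemma avoids_123_iff:
  "avoids p [1, 2, 3] \<longleftrightarrow> (\<forall>k<length p. \<forall>j<k. \<forall>i<j. \<not> (p ! i < p ! j \<and> p ! j < p ! k))"
  unfolding avoids_def occ_123 occ3_def by (auto simp: sum_nonneg_eq_0_iff)

section \<open>Appending a last entry\<close>

definition lower :: "nat list \<Rightarrow> nat \<Rightarrow> nat" where
  "lower p j = (\<Sum>i<j. of_bool (p ! i < p ! j))"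

definition lower_sum :: "(nat \<Rightarrow> 'a :: comm_monoid_add) \<Rightarrow> nat list \<Rightarrow> 'a" where
  "lower_sum \<phi> p = (\<Sum>j<length p. \<phi> (lower p j))"

text \<open>In a permutation, \<open>l\<close> is the number of entries below the new last one.
  Values above \<open>l\<close> move up to make room, which keeps the old relative order.\<close>

definition append_rank :: "nat list \<Rightarrow> nat \<Rightarrow> nat list" where
  "append_rank p l = map (\<lambda>v. if v \<le> l then v else Suc v) p @ [Suc l]"

text \<open>
  \<open>tops p\<close> are the entries playing the \<open>2\<close> of a \<open>12\<close>; a new last entry must not exceed any of them,
  which leaves the values \<open>1, \<dots>, site_count p\<close>.
\<close>

definition tops :: "nat list \<Rightarrow> nat set" where
  "tops p = {p ! j | i j. i < j \<and> j < length p \<and> p ! i < p ! j}"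

definition site_count :: "nat list \<Rightarrow> nat" where
  "site_count p = Min (insert (Suc (length p)) (tops p))"

lemma length_append_rank [simp]: "length (append_rank p l) = Suc (length p)"
  by (simp add: append_rank_def)

lemma append_rank_nth:
  "append_rank p l ! i = (if i < length p then if p ! i \<le> l then p ! i else Suc (p ! i) else Suc l)"
  if "i \<le> length p"
  using that by (auto simp: append_rank_def nth_append)

lemma append_rank_nth_less_iff:
  "i < length p \<Longrightarrow> j < length p \<Longrightarrow> append_rank p l ! i < append_rank p l ! j \<longleftrightarrow> p ! i < p ! j"
  by (auto simp: append_rank_nth)

lemma append_rank_nth_less_last_iff:
  "i < length p \<Longrightarrow> append_rank p l ! i < append_rank p l ! length p \<longleftrightarrow> p ! i \<le> l"
  by (auto simp: append_rank_nth)

lemma append_rank_in_perms: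
  assumes "p \<in> perms n" "l \<le> n"
  shows "append_rank p l \<in> perms (Suc n)"
proof -
  let ?f = "\<lambda>v. if v \<le> l then v else Suc v"
  have p: "distinct p" "set p = {1..n}"
    using assms by (auto simp: permutations_of_set_def)
  have inj: "inj ?f" by (rule injI) (auto split: if_splits)
  have "?f ` {1..n} \<union> {Suc l} = {1..Suc n}"
  proof (rule card_subset_eq)
    show "?f ` {1..n} \<union> {Suc l} \<subseteq> {1..Suc n}"
      using assms by (auto split: if_splits)
    have "card (?f ` {1..n} \<union> {Suc l}) = card (?f ` {1..n}) + card {Suc l}"
      by (rule card_Un_disjoint) (auto split: if_splits)
    also have "\<dots> = Suc n"
      using card_image[OF inj_on_subset[OF inj subset_UNIV], of "{1..n}"] by simp
    finally show "card (?f ` {1..n} \<union> {Suc l}) = card {1..Suc n}" by simp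
  qed simp
  moreover have "set (append_rank p l) = ?f ` {1..n} \<union> {Suc l}"
    by (auto simp: append_rank_def p)
  moreover have "distinct (append_rank p l)"
    using p(1) inj_on_subset[OF inj subset_UNIV] by (auto simp: append_rank_def distinct_map split: if_splits)
  ultimately show ?thesis
    by (auto simp: permutations_of_set_def)
qed

text \<open>The last entry reveals \<open>l\<close>, and the shift is injective; surjectivity
  follows by counting, n! (n + 1) = (n + 1)!.\<close>

lemma bij_betw_append_rank:
  "bij_betw (\<lambda>(p, l). append_rank p l) (perms n \<times> {..n}) (perms (Suc n))"
proof -
  have inj: "inj_on (\<lambda>(p, l). append_rank p l) (perms n \<times> {..n})"
  proof (rule inj_onI, clarify)
    fix p l q m
    assume "append_rank p l = append_rank q m"
    then have lm: "l = m" and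
      eq: "map (\<lambda>v. if v \<le> l then v else Suc v) p = map (\<lambda>v. if v \<le> l then v else Suc v) q"
      by (auto simp: append_rank_def)
    have "inj (\<lambda>v. if v \<le> l then v else Suc v)"
      by (rule injI) (auto split: if_splits)
    with eq lm show "p = q \<and> l = m" by (simp add: inj_map_eq_map)
  qed
  have "(\<lambda>(p, l). append_rank p l) ` (perms n \<times> {..n}) = perms (Suc n)"
  proof (rule card_subset_eq)
    show "card ((\<lambda>(p, l). append_rank p l) ` (perms n \<times> {..n})) = card (perms (Suc n))"
      by (subst card_image[OF inj]) (simp add: card_cartesian_product)
  qed (use append_rank_in_perms in auto)
  with inj show ?thesis by (simp add: bij_betw_def)
qed

lemma finite_tops [simp]: "finite (tops p)"
  by (rule finite_subset[of _ "set p"]) (auto simp: tops_def)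

lemma less_site_count_iff: "l < site_count p \<longleftrightarrow> l \<le> length p \<and> (\<forall>v\<in>tops p. l < v)"
  by (auto simp: site_count_def)

text \<open>A new 123 must use the last entry as its 3, so its 2 is an element of
  \<open>tops p\<close> that is at most \<open>l\<close>.\<close>

lemma avoids_append_rank_iff:
  assumes "p \<in> perms n" "l \<le> n"
  shows "avoids (append_rank p l) [1, 2, 3] \<longleftrightarrow> avoids p [1, 2, 3] \<and> l < site_count p"
proof -
  have len: "length p = n"
    using assms by (simp add: length_finite_permutations_of_set)
  have "avoids (append_rank p l) [1, 2, 3] \<longleftrightarrow>
      (\<forall>k<n. \<forall>j<k. \<forall>i<j. \<not> (append_rank p l ! i < append_rank p l ! j \<and> append_rank p l ! j < append_rank p l ! k))
      \<and> (\<forall>j<n. \<forall>i<j. \<not> (append_rank p l ! i < append_rank p l ! j \<and> append_rank p l ! j < append_rank p l ! n))"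
    unfolding avoids_123_iff by (auto simp: less_Suc_eq len)
  also have "\<dots> \<longleftrightarrow> avoids p [1, 2, 3] \<and> (\<forall>j<n. \<forall>i<j. \<not> (p ! i < p ! j \<and> p ! j \<le> l))"
    unfolding avoids_123_iff using append_rank_nth_less_iff[of _ p _ l] append_rank_nth_less_last_iff[of _ p l]
    by (simp add: len cong: conj_cong imp_cong)
  also have "(\<forall>j<n. \<forall>i<j. \<not> (p ! i < p ! j \<and> p ! j \<le> l)) \<longleftrightarrow> l < site_count p"
    using assms by (auto simp: less_site_count_iff tops_def len not_le)
  finally show ?thesis .
qed

lemma bij_betw_append_rank_Av:
  "bij_betw (\<lambda>(p, l). append_rank p l) (SIGMA p:Av n [1, 2, 3]. {..<site_count p}) (Av (Suc n) [1, 2, 3])"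
proof (rule bij_betw_subset[OF bij_betw_append_rank])
  have len: "p \<in> perms n \<Longrightarrow> length p = n" for p
    by (simp add: length_finite_permutations_of_set)
  show sub: "(SIGMA p:Av n [1, 2, 3]. {..<site_count p}) \<subseteq> perms n \<times> {..n}"
    using len by (auto simp: Av_def less_site_count_iff)
  show "(\<lambda>(p, l). append_rank p l) ` (SIGMA p:Av n [1, 2, 3]. {..<site_count p}) = Av (Suc n) [1, 2, 3]"
  proof (intro equalityI subsetI)
    fix q assume "q \<in> Av (Suc n) [1, 2, 3]"
    then have q: "q \<in> perms (Suc n)" "avoids q [1, 2, 3]" by (auto simp: Av_def)
    then obtain p l where "p \<in> perms n" "l \<le> n" "q = append_rank p l"
      using bij_betw_append_rank[of n] by (fastforce simp: bij_betw_def)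
    with q show "q \<in> (\<lambda>(p, l). append_rank p l) ` (SIGMA p:Av n [1, 2, 3]. {..<site_count p})"
      by (intro image_eqI[of _ _ "(p, l)"])
        (simp_all add: Av_def avoids_append_rank_iff[OF \<open>p \<in> perms n\<close> \<open>l \<le> n\<close>])
  next
    fix q assume "q \<in> (\<lambda>(p, l). append_rank p l) ` (SIGMA p:Av n [1, 2, 3]. {..<site_count p})"
    then obtain p l where "p \<in> Av n [1, 2, 3]" "l < site_count p" "q = append_rank p l" by auto
    with sub show "q \<in> Av (Suc n) [1, 2, 3]"
      by (auto simp: Av_def avoids_append_rank_iff append_rank_in_perms subset_iff)
  qed
qed

text \<open>All old tops exceed \<open>l\<close>, so they move up by one. The new last entry is
  itself a top exactly if \<open>l > 0\<close>, and is then the least one.\<close>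

lemma site_count_append_rank:
  assumes p: "p \<in> perms n" and l: "l < site_count p"
  shows "site_count (append_rank p l) = tree_child (site_count p) l"
proof -
  have len: "length p = n" and set_p: "set p = {1..n}"
    using p by (auto simp: length_finite_permutations_of_set permutations_of_set_def)
  have ln: "l \<le> n" and above: "\<And>v. v \<in> tops p \<Longrightarrow> l < v"
    using l by (auto simp: less_site_count_iff len)
  let ?q = "append_rank p l"
  have less: "?q ! i < ?q ! j \<longleftrightarrow> p ! i < p ! j" if "i < n" "j < n" for i j
    using that by (simp add: append_rank_nth_less_iff len)
  have less_last: "?q ! i < ?q ! n \<longleftrightarrow> p ! i \<le> l" if "i < n" for i
    using that append_rank_nth_less_last_iff[of i p l] by (simp add: len)
  have last: "?q ! n = Suc l"
    by (simp add: append_rank_nth len)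
  have "tops (append_rank p l) =
      {append_rank p l ! j | i j. i < j \<and> j < n \<and> p ! i < p ! j} \<union> {Suc l | i. i < n \<and> p ! i \<le> l}"
  proof -
    have "tops ?q = {?q ! j | i j. i < j \<and> j < n \<and> ?q ! i < ?q ! j} \<union> {?q ! n | i. i < n \<and> ?q ! i < ?q ! n}"
      by (auto simp: tops_def len less_Suc_eq)
    also have "{?q ! j | i j. i < j \<and> j < n \<and> ?q ! i < ?q ! j} = {?q ! j | i j. i < j \<and> j < n \<and> p ! i < p ! j}"
      by (intro Collect_cong ex_cong1 conj_cong refl less) simp_all
    also have "{?q ! n | i. i < n \<and> ?q ! i < ?q ! n} = {Suc l | i. i < n \<and> p ! i \<le> l}"
      unfolding last[symmetric] using less_last by blast
    finally show ?thesis .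
  qed
  also have "{append_rank p l ! j | i j. i < j \<and> j < n \<and> p ! i < p ! j} = Suc ` tops p"
  proof -
    have "?q ! j = Suc (p ! j)" if "i < j" "j < n" "p ! i < p ! j" for i j
      using above[of "p ! j"] that by (force simp: tops_def len append_rank_nth)
    then show ?thesis by (force simp: tops_def len image_iff)
  qed
  \<comment> \<open>For \<open>l > 0\<close> the entry 1 lies below the new last entry; for
    \<open>l = 0\<close> nothing does.\<close>
  also have "{Suc l | i. i < n \<and> p ! i \<le> l} = (if l = 0 then {} else {Suc l})"
  proof (cases "l = 0")
    case True
    have "0 < p ! i" if "i < n" for i
      using nth_mem[of i p] that by (simp add: len set_p)
    with True show ?thesis by auto
  next
    case False
    then have "1 \<in> set p" using ln by (simp add: set_p)
    then obtain i where "i < n" "p ! i = 1" by (auto simp: in_set_conv_nth len)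
    with False show ?thesis by (auto intro!: exI[of _ i])
  qed
  finally have tops: "tops (append_rank p l) = Suc ` tops p \<union> (if l = 0 then {} else {Suc l})" .
  \<comment> \<open>The default value \<open>Suc (length p)\<close> grows by one as well, so it
    shifts together with the tops.\<close>
  let ?S = "Suc ` insert (Suc n) (tops p)"
  have set: "insert (Suc (length (append_rank p l))) (tops (append_rank p l)) =
      (if l = 0 then ?S else insert (Suc l) ?S)"
    by (auto simp: tops len)
  have "Min ?S = Suc (site_count p)"
    unfolding site_count_def len by (rule mono_Min_commute[symmetric]) (auto simp: mono_def)
  moreover from this have "Min (insert (Suc l) ?S) = min (Suc l) (Suc (site_count p))"
    by (subst Min_insert) simp_all
  ultimately show ?thesis
    using l unfolding site_count_def[of "append_rank p l"] set tree_child_def by simp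
qed

lemma lower_append_rank:
  assumes p: "p \<in> perms n" and l: "l \<le> n"
  shows "j < n \<Longrightarrow> lower (append_rank p l) j = lower p j" and "lower (append_rank p l) n = l"
proof -
  have len: "length p = n" and set_p: "set p = {1..n}" and "distinct p"
    using p by (auto simp: length_finite_permutations_of_set permutations_of_set_def)
  show "j < n \<Longrightarrow> lower (append_rank p l) j = lower p j"
    by (simp add: lower_def append_rank_nth_less_iff len)
  have "lower (append_rank p l) n = (\<Sum>i<n. of_bool (p ! i \<le> l))"
    using append_rank_nth_less_last_iff[of _ p l] by (simp add: lower_def len)
  also have "\<dots> = (\<Sum>v\<in>{1..n}. of_bool (v \<le> l))"
    by (rule sum.reindex_bij_betw[of "\<lambda>i. p ! i"])
       (use bij_betw_nth[OF \<open>distinct p\<close>, of "{..<n}" "{1..n}"] in \<open>simp add: len set_p\<close>)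
  also have "\<dots> = card {v \<in> {1..n}. v \<le> l}"
    by (simp add: of_bool_def flip: sum.inter_filter)
  also have "{v \<in> {1..n}. v \<le> l} = {1..l}"
    using l by auto
  finally show "lower (append_rank p l) n = l" by simp
qed

lemma lower_sum_append_rank:
  assumes "p \<in> perms n" "l \<le> n"
  shows "lower_sum \<phi> (append_rank p l) = lower_sum \<phi> p + \<phi> l"
  using assms by (simp add: lower_sum_def lower_append_rank length_finite_permutations_of_set)

section \<open>Sums over the generating tree\<close>

lemma sum_Av_123_Suc:
  "(\<Sum>q\<in>Av (Suc n) [1, 2, 3]. h q) = (\<Sum>p\<in>Av n [1, 2, 3]. \<Sum>l<site_count p. h (append_rank p l))"
proof -
  have "(\<Sum>q\<in>Av (Suc n) [1, 2, 3]. h q) =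
      (\<Sum>(p, l)\<in>(SIGMA p:Av n [1, 2, 3]. {..<site_count p}). h (append_rank p l))"
    using sum.reindex_bij_betw[OF bij_betw_append_rank_Av[of n], of h, symmetric]
    by (simp only: case_prod_unfold)
  also have "\<dots> = (\<Sum>p\<in>Av n [1, 2, 3]. \<Sum>l<site_count p. h (append_rank p l))"
    by (rule sum.Sigma[symmetric]) (auto simp only: finite_Av finite_lessThan)
  finally show ?thesis .
qed

text \<open>Each avoider of length \<open>n\<close> is the root of a subtree whose level
  \<open>m\<close> lies in length \<open>n + m\<close>. The start \<open>n\<close> must vary,
  because \<open>tree_paths\<close> splits off the first step and not the last.\<close>

lemma card_Av_123_add:
  "of_nat (card (Av (n + m) [1, 2, 3])) =
     (\<Sum>p\<in>Av n [1, 2, 3]. tree_paths m (site_count p) :: 'a :: comm_semiring_1)"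
proof (induction m arbitrary: n)
  case (Suc m)
  have "of_nat (card (Av (n + Suc m) [1, 2, 3])) =
      (\<Sum>q\<in>Av (Suc n) [1, 2, 3]. tree_paths m (site_count q) :: 'a)"
    using Suc[of "Suc n"] by simp
  also have "\<dots> = (\<Sum>p\<in>Av n [1, 2, 3]. tree_paths (Suc m) (site_count p))"
    unfolding sum_Av_123_Suc tree_paths.simps
    by (intro sum.cong refl arg_cong[of _ _ "tree_paths m"] site_count_append_rank) (auto simp: Av_def)
  finally show ?case .
qed simp

text \<open>Every descendant inherits the \<open>lower_sum\<close> of its ancestor, and each step
  adds only \<open>\<phi> l\<close>.\<close>

lemma sum_lower_sum_Av_123_add:
  fixes \<phi> :: "nat \<Rightarrow> 'a :: comm_semiring_1"
  shows "(\<Sum>p\<in>Av (n + m) [1, 2, 3]. lower_sum \<phi> p) =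
    (\<Sum>p\<in>Av n [1, 2, 3]. tree_paths m (site_count p) * lower_sum \<phi> p + tree_weight \<phi> m (site_count p))"
proof (induction m arbitrary: n)
  case (Suc m)
  let ?h = "\<lambda>p. tree_paths m (site_count p) * lower_sum \<phi> p + tree_weight \<phi> m (site_count p)"
  have "(\<Sum>p\<in>Av (n + Suc m) [1, 2, 3]. lower_sum \<phi> p) = (\<Sum>q\<in>Av (Suc n) [1, 2, 3]. ?h q)"
    using Suc[of "Suc n"] by simp
  also have "\<dots> = (\<Sum>p\<in>Av n [1, 2, 3]. tree_paths (Suc m) (site_count p) * lower_sum \<phi> p
      + tree_weight \<phi> (Suc m) (site_count p))"
    unfolding sum_Av_123_Suc
  proof (rule sum.cong[OF refl])
    fix p assume "p \<in> Av n [1, 2, 3]"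
    then have p: "p \<in> perms n" by (simp add: Av_def)
    have "?h (append_rank p l) =
      tree_paths m (tree_child (site_count p) l) * (lower_sum \<phi> p + \<phi> l) +
         tree_weight \<phi> m (tree_child (site_count p) l)" if "l < site_count p" for l
      using site_count_append_rank[OF p that] lower_sum_append_rank[OF p, of l \<phi>] that
        length_finite_permutations_of_set[OF p] by (simp add: less_site_count_iff)
    then show "(\<Sum>l<site_count p. ?h (append_rank p l)) = tree_paths (Suc m) (site_count p) * lower_sum \<phi> p
      + tree_weight \<phi> (Suc m) (site_count p)"
      by (simp add: sum.distrib sum_distrib_left sum_distrib_right algebra_simps)
  qed
  finally show ?case .
qed simp

lemma Av_0_123: "Av 0 [1, 2, 3] = {[]}"
  using avoids_123_iff[of "[]"] by (auto simp: Av_def)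

lemma site_count_Nil: "site_count [] = Suc 0"
  by (simp add: site_count_def tops_def)

lemma card_Av_123: "of_nat (card (Av n [1, 2, 3])) = tree_paths n (Suc 0)"
  using card_Av_123_add[of 0 n] unfolding Av_0_123 by (simp add: site_count_Nil)

lemma sum_lower_sum_Av_123:
  "(\<Sum>p\<in>Av n [1, 2, 3]. lower_sum \<phi> p) = tree_weight \<phi> n (Suc 0)"
  using sum_lower_sum_Av_123_add[of \<phi> 0 n] unfolding Av_0_123 by (simp add: site_count_Nil lower_sum_def)

section \<open>Counting 321 through pairs and triples\<close>

lemma sum_pairs_add:
  "(\<Sum>j<n. \<Sum>i<j. b i + b j) = (of_nat n - 1 :: 'a :: comm_ring_1) * (\<Sum>i<n. b i)"
  by (induction n) (simp_all add: sum.distrib algebra_simps)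

text \<open>Double counting: each pair of positions lies in \<open>n - 2\<close> triples. The
  subtraction is in a ring, so small \<open>n\<close> needs no exception.\<close>

lemma sum_triples_add:
  "(\<Sum>k<n. \<Sum>j<k. \<Sum>i<j. a i j + (a i k + a j k)) =
     (of_nat n - 2 :: 'a :: comm_ring_1) * (\<Sum>j<n. \<Sum>i<j. a i j)"
proof (induction n)
  case (Suc n)
  have step: "(\<Sum>j<n. \<Sum>i<j. a i j + (a i n + a j n)) =
      (\<Sum>j<n. \<Sum>i<j. a i j) + (of_nat n - 1) * (\<Sum>i<n. a i n)"
    by (simp add: sum.distrib flip: sum_pairs_add)
  show ?case
    unfolding sum.lessThan_Suc step Suc by (simp add: algebra_simps)
qed simp

lemma sum_choose_two: "(\<Sum>j<n. j) = n choose 2"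
  by (induction n) (simp_all add: numeral_2_eq_2)

lemma sum_choose_three: "(\<Sum>k<n. \<Sum>j<k. j) = n choose 3"
  unfolding sum_choose_two by (induction n) (simp_all add: numeral_3_eq_3 numeral_2_eq_2)

lemma sum_pairs_of_bool:
  fixes k :: nat
  shows "(\<Sum>j<k. \<Sum>i<j. of_bool (R i \<and> R j)) = (\<Sum>i<k. of_bool (R i)) choose 2"
  by (induction k) (auto simp: numeral_2_eq_2 One_nat_def)

text \<open>Two entries to the left of a larger one must descend, as an ascent would complete a 123;
  hence any two of them give a 213.\<close>

lemma occ3_213:
  assumes "distinct p" "avoids p [1, 2, 3]"
  shows "occ3 (\<lambda>x y z. y < x \<and> x < z) p = lower_sum (\<lambda>l. l choose 2) p"
  unfolding occ3_def lower_sum_def lower_def sum_pairs_of_bool[symmetric]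
proof (intro sum.cong refl arg_cong[of _ _ of_bool])
  fix k j i assume "k \<in> {..<length p}" "j \<in> {..<k}" "i \<in> {..<j}"
  then show "(p ! j < p ! i \<and> p ! i < p ! k) = (p ! i < p ! k \<and> p ! j < p ! k)"
    using assms nth_eq_iff_index_eq[of p i j] by (force simp: avoids_123_iff)
qed

text \<open>
  On a triple that is not \<open>123\<close>, the number of ascending pairs is \<open>0\<close> for \<open>321\<close>, \<open>1\<close> for \<open>231\<close> and \<open>312\<close>, and
  \<open>2\<close> for \<open>132\<close> and \<open>213\<close>; each ascending pair lies in \<open>n - 2\<close> triples.
\<close>

lemma occ3_321:
  assumes "distinct p" "avoids p [1, 2, 3]"
  shows "of_nat (occ3 (\<lambda>x y z. z < y \<and> y < x) p) =
     (of_nat (length p choose 3) - (of_nat (length p) - 2) * lower_sum of_nat p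
       + of_nat (occ3 (\<lambda>x y z. x < z \<and> z < y) p) + of_nat (occ3 (\<lambda>x y z. y < x \<and> x < z) p) :: 'a :: comm_ring_1)"
proof -
  let ?a = "\<lambda>i j. of_bool (p ! i < p ! j) :: 'a"
  have "of_nat (occ3 (\<lambda>x y z. z < y \<and> y < x) p) = (\<Sum>k<length p. \<Sum>j<k. \<Sum>i<j.
      1 - (?a i j + (?a i k + ?a j k)) + of_bool (p ! i < p ! k \<and> p ! k < p ! j)
       + of_bool (p ! j < p ! i \<and> p ! i < p ! k))"
    unfolding occ3_def of_nat_sum
  proof (intro sum.cong refl)
    fix k j i assume "k \<in> {..<length p}" "j \<in> {..<k}" "i \<in> {..<j}"
    then have "p ! i \<noteq> p ! j" "p ! i \<noteq> p ! k" "p ! j \<noteq> p ! k" "\<not> (p ! i < p ! j \<and> p ! j < p ! k)"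
      using assms by (auto simp: nth_eq_iff_index_eq avoids_123_iff)
    then show "of_nat (of_bool (p ! k < p ! j \<and> p ! j < p ! i)) =
      1 - (?a i j + (?a i k + ?a j k)) + of_bool (p ! i < p ! k \<and> p ! k < p ! j)
       + of_bool (p ! j < p ! i \<and> p ! i < p ! k)"
      by (auto simp: of_bool_def)
  qed
  also have "\<dots> = of_nat (\<Sum>k<length p. \<Sum>j<k. j) - (\<Sum>k<length p. \<Sum>j<k. \<Sum>i<j. ?a i j + (?a i k + ?a j k))
      + of_nat (occ3 (\<lambda>x y z. x < z \<and> z < y) p) + of_nat (occ3 (\<lambda>x y z. y < x \<and> x < z) p)"
    unfolding occ3_def by (simp only: sum.distrib sum_subtractf of_nat_sum of_nat_of_bool sum_constant card_lessThan mult_1_right)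
  also have "(\<Sum>k<length p. \<Sum>j<k. \<Sum>i<j. ?a i j + (?a i k + ?a j k)) = (of_nat (length p) - 2) * lower_sum of_nat p"
    unfolding sum_triples_add by (simp add: lower_sum_def lower_def)
  finally show ?thesis
    by (simp only: sum_choose_three)
qed

section \<open>Reverse-complement symmetry\<close>

lemma occ3_rev: "occ3 Q (rev p) = occ3 (\<lambda>x y z. Q z y x) p"
  unfolding occ3_eq_card
proof (rule bij_betw_same_card)
  \<comment> \<open>Positions start at 0, so reversal sends \<open>i\<close> to
    \<open>length p - Suc i\<close>; the map on triples is its own inverse.\<close>
  let ?f = "\<lambda>(k, j, i). (length p - Suc i, length p - Suc j, length p - Suc k)"
  show "bij_betw ?f {(k, j, i). i < j \<and> j < k \<and> k < length (rev p) \<and> Q (rev p ! i) (rev p ! j) (rev p ! k)}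
      {(k, j, i). i < j \<and> j < k \<and> k < length p \<and> Q (p ! k) (p ! j) (p ! i)}"
    by (rule bij_betw_byWitness[where f' = ?f]) (auto simp: rev_nth)
qed

lemma occ3_map: "occ3 Q (map f p) = occ3 (\<lambda>x y z. Q (f x) (f y) (f z)) p"
  by (simp add: occ3_def)

text \<open>The restriction to entries of \<open>p\<close> matters for \<open>Suc n - v\<close>,
  which reverses the order only as long as subtraction does not truncate.\<close>

lemma occ3_cong:
  assumes "\<And>x y z. x \<in> set p \<Longrightarrow> y \<in> set p \<Longrightarrow> z \<in> set p \<Longrightarrow> Q x y z = Q' x y z"
  shows "occ3 Q p = occ3 Q' p"
  unfolding occ3_def by (intro sum.cong refl arg_cong[of _ _ of_bool] assms) auto

definition rev_complement :: "nat \<Rightarrow> nat list \<Rightarrow> nat list" where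
  "rev_complement n p = rev (map (\<lambda>v. Suc n - v) p)"

lemma occ3_rev_complement:
  "occ3 Q (rev_complement n p) = occ3 (\<lambda>x y z. Q (Suc n - z) (Suc n - y) (Suc n - x)) p"
  by (simp add: rev_complement_def occ3_rev occ3_map)

lemma rev_complement_in_Av_123:
  assumes "p \<in> Av n [1, 2, 3]"
  shows "rev_complement n p \<in> Av n [1, 2, 3]"
proof -
  have p: "set p = {1..n}" "distinct p" "occ3 (\<lambda>x y z. x < y \<and> y < z) p = 0"
    using assms by (auto simp: Av_def permutations_of_set_def avoids_def occ_123[simplified])
  have "(\<lambda>v. Suc n - v) ` {1..n} = {1..n}"
    by (rule bij_betw_imp_surj_on[OF bij_betw_byWitness[where f' = "\<lambda>v. Suc n - v"]]) auto
  then have "set (rev_complement n p) = {1..n}"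
    by (simp add: rev_complement_def p)
  moreover have "distinct (rev_complement n p)"
    using p by (auto simp: rev_complement_def distinct_map inj_on_def)
  moreover have "occ3 (\<lambda>x y z. x < y \<and> y < z) (rev_complement n p) = occ3 (\<lambda>x y z. x < y \<and> y < z) p"
    unfolding occ3_rev_complement by (rule occ3_cong) (auto simp: p)
  ultimately show ?thesis
    using p(3) unfolding Av_def avoids_def occ_123 permutations_of_set_def by simp
qed

lemma rev_complement_rev_complement:
  assumes "p \<in> Av n r"
  shows "rev_complement n (rev_complement n p) = p"
  using assms unfolding rev_complement_def
  by (auto simp: Av_def permutations_of_set_def rev_map intro!: map_idI)

text \<open>Reverse-complement is an involution on the class and exchanges 132 with 213.\<close>

lemma sum_occ3_132_eq_213:
  "(\<Sum>p\<in>Av n [1, 2, 3]. occ3 (\<lambda>x y z. x < z \<and> z < y) p) =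
   (\<Sum>p\<in>Av n [1, 2, 3]. occ3 (\<lambda>x y z. y < x \<and> x < z) p)"
proof (rule sum.reindex_bij_witness[of _ "rev_complement n" "rev_complement n"])
  fix p assume p: "p \<in> Av n [1, 2, 3]"
  then have "set p = {1..n}"
    by (simp add: Av_def permutations_of_set_def)
  then show "occ3 (\<lambda>x y z. y < x \<and> x < z) (rev_complement n p) = occ3 (\<lambda>x y z. x < z \<and> z < y) p"
    unfolding occ3_rev_complement by (intro occ3_cong) auto
qed (simp_all only: rev_complement_in_Av_123 rev_complement_rev_complement)

section \<open>The total number of 321 patterns\<close>

text \<open>Sum of the triple identity over the class. The constant term yields the cardinality, and
  132 and 213 contribute equally, whence the factor 2.\<close>

lemma total_occ_321_Av_123:
  "of_nat (total_occ [3, 2, 1] (Av n [1, 2, 3])) = of_nat (n choose 3) * tree_paths n (Suc 0)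
     - (of_nat n - 2) * tree_weight of_nat n (Suc 0)
     + (2 :: 'a :: comm_ring_1) * tree_weight (\<lambda>l. of_nat (l choose 2)) n (Suc 0)"
proof -
  have 213: "of_nat (\<Sum>p\<in>Av n [1, 2, 3]. occ3 (\<lambda>x y z. y < x \<and> x < z) p) =
      (tree_weight (\<lambda>l. of_nat (l choose 2)) n (Suc 0) :: 'a)"
  proof -
    have "of_nat (\<Sum>p\<in>Av n [1, 2, 3]. occ3 (\<lambda>x y z. y < x \<and> x < z) p) =
      (\<Sum>p\<in>Av n [1, 2, 3]. lower_sum (\<lambda>l. of_nat (l choose 2)) p :: 'a)"
      unfolding of_nat_sum
      by (intro sum.cong refl) (simp add: Av_def permutations_of_set_def occ3_213 lower_sum_def)
    then show ?thesis by (simp only: sum_lower_sum_Av_123)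
  qed
  have "of_nat (total_occ [3, 2, 1] (Av n [1, 2, 3])) = (\<Sum>p\<in>Av n [1, 2, 3].
     of_nat (n choose 3) - (of_nat n - 2) * lower_sum of_nat p
       + of_nat (occ3 (\<lambda>x y z. x < z \<and> z < y) p) + of_nat (occ3 (\<lambda>x y z. y < x \<and> x < z) p) :: 'a)"
    unfolding total_occ_def of_nat_sum occ_321
  proof (rule sum.cong[OF refl])
    fix p assume "p \<in> Av n [1, 2, 3]"
    then have "distinct p" "avoids p [1, 2, 3]" "length p = n"
      by (auto simp only: Av_def mem_Collect_eq permutations_of_set_def length_finite_permutations_of_set)
        (simp add: distinct_card[symmetric])
    then show "of_nat (occ3 (\<lambda>x y z. z < y \<and> y < x) p) = (of_nat (n choose 3) - (of_nat n - 2) * lower_sum of_nat p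
       + of_nat (occ3 (\<lambda>x y z. x < z \<and> z < y) p) + of_nat (occ3 (\<lambda>x y z. y < x \<and> x < z) p) :: 'a)"
      using occ3_321[of p] by blast
  qed
  also have "\<dots> = of_nat (n choose 3) * of_nat (card (Av n [1, 2, 3])) - (of_nat n - 2) * (\<Sum>p\<in>Av n [1, 2, 3]. lower_sum of_nat p)
     + of_nat (\<Sum>p\<in>Av n [1, 2, 3]. occ3 (\<lambda>x y z. x < z \<and> z < y) p)
     + of_nat (\<Sum>p\<in>Av n [1, 2, 3]. occ3 (\<lambda>x y z. y < x \<and> x < z) p)"
    by (simp only: sum.distrib sum_subtractf of_nat_sum sum_constant sum_distrib_left mult.commute)
  finally show ?thesis
    unfolding sum_occ3_132_eq_213 213 card_Av_123 sum_lower_sum_Av_123 by simp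
qed

theorem corollary22:
  fixes d :: "nat \<Rightarrow> nat" and x :: "rat fls"
  defines "d \<equiv> \<lambda>n. total_occ [3, 2, 1] (Av n [1, 2, 3])"
    and "x \<equiv> fls_X"
  shows "fps_to_fls (Abs_fps (\<lambda>n. of_nat (d n))) =
           1 / (2 * x) *
             ((8 * x ^ 3 - 20 * x ^ 2 + 8 * x - 1) / (1 - 4 * x) ^ 2
              - (36 * x ^ 3 - 34 * x ^ 2 + 10 * x - 1) / fps_to_fls (one_minus_4x_powr (5 / 2)))"
proof (rule fls_pattern_321)
  show "2 * fps_X * one_minus_4x_powr (5 / 2) * Abs_fps (\<lambda>n. of_nat (d n)) =
    (8 * fps_X ^ 3 - 20 * fps_X ^ 2 + 8 * fps_X - 1) * sqrt_fps
      - (36 * fps_X ^ 3 - 34 * fps_X ^ 2 + 10 * fps_X - 1)"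
    by (rule fps_pattern_321) (simp only: d_def total_occ_321_Av_123)
qed (simp add: x_def)

end
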